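(* Let $n\ge 1$ be an integer and let $k=4n^{2/3}$. Then any two convex sets $P_1$, $P_2$ of $n$ points each in the plane can be labeled (each bijectively by $\{1,\dots,n\}$) such that the largest compatible matching of the two resulting labeled point sets consists of fewer than $k$ edges.
   Context: A convex set of points is a finite set of points in the plane in (strictly) convex position. A labeling of a set of $n$ points is a bijection between the points and $\{1,\dots,n\}$. A matching is a set of pairwise disjoint 2-element subsets (edges) of $\{1,\dots,n\}$. It is compatible to several labeled point sets if, on each of them, its straight-line drawing (edge $\{a,b\}$ drawn as the segment between the points labeled $a$ and $b$) is crossing-free. *)

theory Defs
  imports "HOL-Analysis.Analysis"
begin

type_synonym point = "real ^ 2"

text \<open>Finite point sets in strictly convex position, i.e. every point is a vertex of the convex
  hull. This is not the library's \<^const>\<open>convex\<close>.\<close>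

definition convex_point_set :: "point set \<Rightarrow> bool" where
  "convex_point_set P \<longleftrightarrow> finite P \<and> (\<forall>p\<in>P. p \<notin> convex hull (P - {p}))"

text \<open>A labeling is represented as the map from labels to points; its values outside
  \<open>{1..n}\<close> are irrelevant.\<close>

definition labeling :: "nat \<Rightarrow> point set \<Rightarrow> (nat \<Rightarrow> point) \<Rightarrow> bool" where
  "labeling n P l \<longleftrightarrow> bij_betw l {1..n} P"

definition matching :: "nat \<Rightarrow> nat set set \<Rightarrow> bool" where
  "matching n M \<longleftrightarrow> (\<forall>e\<in>M. e \<subseteq> {1..n} \<and> card e = 2) \<and> pairwise disjnt M"

text \<open>Distinct edges of a matching share no endpoint, so being crossing-free means that their
  closed segments are disjoint.\<close>

definition crossing_free :: "(nat \<Rightarrow> point) \<Rightarrow> nat set set \<Rightarrow> bool" where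
  "crossing_free l M \<longleftrightarrow>
    (\<forall>a b c d. {a, b} \<in> M \<longrightarrow> {c, d} \<in> M \<longrightarrow> {a, b} \<noteq> {c, d} \<longrightarrow>
      closed_segment (l a) (l b) \<inter> closed_segment (l c) (l d) = {})"

definition compatible_matching :: "nat \<Rightarrow> (nat \<Rightarrow> point) set \<Rightarrow> nat set set \<Rightarrow> bool" where
  "compatible_matching n L M \<longleftrightarrow> matching n M \<and> (\<forall>l\<in>L. crossing_free l M)"

definition max_compatible_matching_size :: "nat \<Rightarrow> (nat \<Rightarrow> point) set \<Rightarrow> nat" where
  "max_compatible_matching_size n L = Max (card ` {M. compatible_matching n L M})"

text \<open>The maximum is taken over a finite nonempty set of finite matchings.\<close>

lemma matching_finite: "matching n M \<Longrightarrow> finite M"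
  by (rule finite_subset[of _ "Pow {1..n}"]) (auto simp: matching_def)

lemma compatible_matchings_finite: "finite {M. compatible_matching n L M}"
  by (rule finite_subset[of _ "Pow (Pow {1..n})"])
    (auto simp: compatible_matching_def matching_def)

lemma compatible_matching_empty: "compatible_matching n L {}"
  by (simp add: compatible_matching_def matching_def crossing_free_def)

end

theory Submission
  imports Defs "HOL-Combinatorics.Permutations"
begin

text \<open>
  Enumerate each convex set in its angular order, so that segments whose labels interleave
  cross, and label the second set by a permutation of its enumeration. A non-crossing matching
  is determined by its set of opening and its set of closing endpoints, so at most
  \<open>(n choose K)\<^sup>2\<close> matchings with \<open>K\<close> edges are non-crossing on the first set. Orienting the
  edges of such a matching by their order on the second set (in \<open>2 ^ K\<close> ways), at most one of
  the \<open>K!\<close> rearrangements of the closing endpoints is non-crossing; so at most \<open>2 ^ K * n! / K!\<close>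
  permutations keep it non-crossing. The product of the two bounds is less than \<open>n!\<close> as soon as
  \<open>K \<ge> 4 n\<^bsup>2/3\<^esup>\<close>, hence some permutation admits no compatible matching with \<open>K\<close> edges.
\<close>

subsection \<open>Cyclic enumeration of a convex point set\<close>

text \<open>Twice the signed area of the triangle \<open>p q r\<close>: positive for a
  counterclockwise turn, zero for collinear points.\<close>

definition orient :: "point \<Rightarrow> point \<Rightarrow> point \<Rightarrow> real" where
  "orient p q r = (q$1 - p$1) * (r$2 - p$2) - (q$2 - p$2) * (r$1 - p$1)"

text \<open>Four points in the plane are affinely dependent, and by Cramer's rule signed areas serve
  as coefficients. Together with \<open>orient_sum\<close>, once the common total is divided out,
  both sides describe the point where the lines \<open>a c\<close> and \<open>b d\<close>
  meet.\<close>

lemma orient_affine_dependence: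
  "orient b c d *\<^sub>R a + orient a b d *\<^sub>R c = orient a c d *\<^sub>R b + orient a b c *\<^sub>R d"
  by (simp add: vec_eq_iff forall_2 orient_def) algebra

lemma orient_sum: "orient b c d + orient a b d = orient a c d + orient a b c"
  by (simp add: orient_def algebra_simps)

lemma weighted_mean_in_closed_segment:
  fixes a c x :: "'a::real_vector"
  assumes "s > 0" "t > 0" "(s + t) *\<^sub>R x = s *\<^sub>R a + t *\<^sub>R c"
  shows "x \<in> closed_segment a c"
proof -
  have "x = (1 / (s + t)) *\<^sub>R ((s + t) *\<^sub>R x)"
    using assms(1,2) by simp
  also have "\<dots> = (s / (s + t)) *\<^sub>R a + (t / (s + t)) *\<^sub>R c"
    unfolding assms(3) by (simp add: scaleR_add_right)
  also have "s / (s + t) = 1 - t / (s + t)"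
    using assms(1,2) by (simp add: field_simps)
  finally show ?thesis
    unfolding closed_segment_def using assms(1,2) by (auto intro!: exI[of _ "t / (s + t)"])
qed

lemma positively_oriented_diagonals_cross:
  assumes "orient a b c > 0" "orient a b d > 0" "orient a c d > 0" "orient b c d > 0"
  shows "closed_segment a c \<inter> closed_segment b d \<noteq> {}"
proof -
  define s where "s = orient b c d + orient a b d"
  define x where "x = (1 / s) *\<^sub>R (orient b c d *\<^sub>R a + orient a b d *\<^sub>R c)"
  have "s > 0" using assms by (simp add: s_def)
  then have x: "s *\<^sub>R x = orient b c d *\<^sub>R a + orient a b d *\<^sub>R c"
    by (simp add: x_def)
  have "x \<in> closed_segment a c"
    using x assms unfolding s_def by (intro weighted_mean_in_closed_segment)
  moreover have "x \<in> closed_segment b d"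
    using x assms unfolding s_def orient_sum orient_affine_dependence
    by (intro weighted_mean_in_closed_segment)
  ultimately show ?thesis by blast
qed

lemma convex_point_setD:
  assumes "convex_point_set P" "p \<in> P" "Q \<subseteq> P" "p \<notin> Q"
  shows "p \<notin> convex hull Q"
  using assms hull_mono[of Q "P - {p}" convex] unfolding convex_point_set_def by blast

text \<open>Were \<open>orient a b c\<close> not positive, the affine dependence would make
  \<open>b\<close> a convex combination of \<open>p\<close>, \<open>a\<close> and \<open>c\<close>,
  against convex position.\<close>

lemma orient_pos_of_fan:
  assumes P: "convex_point_set P" "{p, a, b, c} \<subseteq> P"
    and pos: "orient p a b > 0" "orient p b c > 0" "orient p a c > 0"
  shows "orient a b c > 0"
proof (rule ccontr)
  assume "\<not> orient a b c > 0"
  define s where "s = orient p a c"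
  have b: "b = (- orient a b c / s) *\<^sub>R p + (orient p b c / s) *\<^sub>R a + (orient p a b / s) *\<^sub>R c"
  proof -
    \<comment> \<open>Variables are instantiated in their order of occurrence \<open>b\<close>,
      \<open>c\<close>, \<open>d\<close>, \<open>a\<close>, so \<open>p\<close> takes the role of
      \<open>a\<close>.\<close>
    have "s *\<^sub>R b = (- orient a b c) *\<^sub>R p + orient p b c *\<^sub>R a + orient p a b *\<^sub>R c"
      using orient_affine_dependence[of a b c p] by (simp add: s_def algebra_simps)
    then have "(1 / s) *\<^sub>R (s *\<^sub>R b)
        = (1 / s) *\<^sub>R ((- orient a b c) *\<^sub>R p + orient p b c *\<^sub>R a + orient p a b *\<^sub>R c)"
      by simp
    then show ?thesis using pos by (simp add: s_def scaleR_add_right scaleR_diff_right)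
  qed
  have sum: "- orient a b c / s + orient p b c / s + orient p a b / s = 1"
    using orient_sum[of a b c p] pos by (simp add: s_def field_simps)
  have "b \<in> convex hull {p, a, c}"
    unfolding convex_hull_3
    using b sum pos \<open>\<not> orient a b c > 0\<close>
    by (intro CollectI exI[of _ "- orient a b c / s"] exI[of _ "orient p b c / s"]
        exI[of _ "orient p a b / s"]) (auto simp: s_def divide_nonpos_pos)
  moreover have "b \<notin> {p, a, c}"
    using pos by (auto simp: orient_def)
  ultimately show False
    using convex_point_setD[OF P(1), of b "{p, a, c}"] P(2) by auto
qed

section \<open>Angular order around the lexicographically least point\<close>

text \<open>Seen from the least point \<open>p\<close>, all other points lie in one half-open
  half-plane. There the turn around \<open>p\<close> compares angles and can be used for
  sorting.\<close>

definition lex_less :: "point \<Rightarrow> point \<Rightarrow> bool" where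
  "lex_less p q \<longleftrightarrow> p$1 < q$1 \<or> p$1 = q$1 \<and> p$2 < q$2"

lemma ex_lex_least:
  assumes "finite P" "P \<noteq> {}"
  shows "\<exists>p\<in>P. \<forall>q\<in>P - {p}. lex_less p q"
  using assms
proof (induction rule: finite_ne_induct)
  case (singleton x)
  then show ?case by simp
next
  case (insert x F)
  then obtain p where p: "p \<in> F" "\<forall>q\<in>F - {p}. lex_less p q" by blast
  have "x \<noteq> p" using insert p by blast
  then have "lex_less x p \<or> lex_less p x"
    by (auto simp: lex_less_def vec_eq_iff forall_2)
  moreover have "lex_less x q" if "lex_less x p" "lex_less p q" for q
    using that by (auto simp: lex_less_def)
  ultimately show ?case using p by blast
qed

text \<open>Taking \<open>p\<close> as the origin, the identity \<open>id\<close> expresses the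
  cross product of the outer pair, scaled by \<open>v1\<close>, through the two given positive ones.
  Its coefficients are nonnegative in the half-plane.\<close>

lemma orient_trans:
  assumes "lex_less p a" "lex_less p b" "lex_less p c"
    and "orient p a b > 0" "orient p b c > 0"
  shows "orient p a c > 0"
proof -
  define u1 u2 v1 v2 w1 w2 where uvw: "u1 = a$1 - p$1" "u2 = a$2 - p$2"
    "v1 = b$1 - p$1" "v2 = b$2 - p$2" "w1 = c$1 - p$1" "w2 = c$2 - p$2"
  have lex: "u1 > 0 \<or> u1 = 0 \<and> u2 > 0" "v1 > 0 \<or> v1 = 0 \<and> v2 > 0" "w1 > 0 \<or> w1 = 0 \<and> w2 > 0"
    using assms(1-3) unfolding lex_less_def uvw by auto
  have uv: "u1 * v2 - u2 * v1 > 0" and vw: "v1 * w2 - v2 * w1 > 0"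
    using assms(4,5) unfolding orient_def uvw by auto
  have id: "v1 * (u1 * w2 - u2 * w1) = u1 * (v1 * w2 - v2 * w1) + w1 * (u1 * v2 - u2 * v1)"
    by algebra
  \<comment> \<open>The upward vertical is the last direction in the half-plane, so nothing follows
    it counterclockwise.\<close>
  have "u1 \<noteq> 0"
  proof
    assume "u1 = 0"
    then have "u2 > 0" "u2 * v1 < 0" using lex uv by auto
    then show False using lex(2) by (auto simp: mult_less_0_iff)
  qed
  then have "u1 > 0" using lex by auto
  then have "v1 * (u1 * w2 - u2 * w1) > 0"
    unfolding id using uv vw lex(3) by (intro add_pos_nonneg mult_pos_pos mult_nonneg_nonneg) auto
  then have "u1 * w2 - u2 * w1 > 0"
    using lex(2) by (auto simp: zero_less_mult_iff)
  then show ?thesis unfolding orient_def uvw .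
qed

text \<open>Collinearity within the half-open half-plane puts \<open>a\<close> and \<open>b\<close>
  on one ray from \<open>p\<close>; the nearer one lies between \<open>p\<close> and the
  other.\<close>

lemma orient_eq_0_lex_less:
  assumes "lex_less p a" "lex_less p b" "orient p a b = 0"
  shows "a \<in> closed_segment p b \<or> b \<in> closed_segment p a"
proof -
  have *: "x \<in> closed_segment p y"
    if xy: "lex_less p x" "lex_less p y" "orient p x y = 0"
      "x$1 - p$1 < y$1 - p$1 \<or> x$1 = y$1 \<and> x$2 - p$2 \<le> y$2 - p$2" for x y
  proof -
    obtain t where t: "0 \<le> t" "t \<le> 1" "t * (y$1 - p$1) = x$1 - p$1" "t * (y$2 - p$2) = x$2 - p$2"
    proof (cases "y$1 = p$1")
      case True
      then have "x$1 = p$1" "x$2 > p$2" "y$2 > p$2" "x$2 \<le> y$2"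
        using xy unfolding lex_less_def by auto
      then show ?thesis using True by (intro that[of "(x$2 - p$2) / (y$2 - p$2)"]) auto
    next
      case False
      then have "y$1 > p$1" "x$1 \<ge> p$1" "x$1 \<le> y$1"
        using xy unfolding lex_less_def by auto
      moreover have "(x$1 - p$1) * (y$2 - p$2) = (x$2 - p$2) * (y$1 - p$1)"
        using xy(3) by (simp add: orient_def)
      ultimately show ?thesis by (intro that[of "(x$1 - p$1) / (y$1 - p$1)"]) auto
    qed
    then have "x = (1 - t) *\<^sub>R p + t *\<^sub>R y"
      by (simp add: vec_eq_iff forall_2 algebra_simps)
    then show ?thesis unfolding closed_segment_def using t by auto
  qed
  have "orient p b a = 0" using assms(3) by (simp add: orient_def algebra_simps)
  then show ?thesis
    using *[of a b] *[of b a] assms by fastforce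
qed

lemma orient_neq_0:
  assumes P: "convex_point_set P" "{p, a, b} \<subseteq> P"
    and "lex_less p a" "lex_less p b" "a \<noteq> b"
  shows "orient p a b \<noteq> 0"
proof
  assume "orient p a b = 0"
  then consider "a \<in> convex hull {p, b}" | "b \<in> convex hull {p, a}"
    using orient_eq_0_lex_less assms unfolding segment_convex_hull by blast
  moreover have "a \<noteq> p" "b \<noteq> p" using assms by (auto simp: lex_less_def)
  ultimately show False
    using convex_point_setD[OF P(1), of a "{p, b}"] convex_point_setD[OF P(1), of b "{p, a}"]
      assms by cases auto
qed

text \<open>The rank of an element, one plus the number of its predecessors, is a strictly
  increasing bijection onto \<open>{1..card S}\<close>; its inverse is the enumeration.\<close>

lemma ex_increasing_enumeration:
  assumes fin: "finite S"
    and irrefl: "\<And>x. x \<in> S \<Longrightarrow> \<not> r x x"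
    and trans: "\<And>x y z. \<lbrakk>x \<in> S; y \<in> S; z \<in> S; r x y; r y z\<rbrakk> \<Longrightarrow> r x z"
    and total: "\<And>x y. \<lbrakk>x \<in> S; y \<in> S; x \<noteq> y\<rbrakk> \<Longrightarrow> r x y \<or> r y x"
  shows "\<exists>l. bij_betw l {1..card S} S \<and> (\<forall>i\<in>{1..card S}. \<forall>j\<in>{1..card S}. i < j \<longrightarrow> r (l i) (l j))"
proof -
  define h where "h x = Suc (card {y \<in> S. r y x})" for x
  have mono: "h x < h y" if "x \<in> S" "y \<in> S" "r x y" for x y
  proof -
    have "{z \<in> S. r z x} \<subset> {z \<in> S. r z y}" using that irrefl trans by blast
    then show ?thesis unfolding h_def using fin by (simp add: psubset_card_mono)
  qed
  have inj: "inj_on h S"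
    by (rule inj_onI) (metis mono total less_irrefl)
  have "h x \<in> {1..card S}" if "x \<in> S" for x
  proof -
    have "{y \<in> S. r y x} \<subset> S" using that irrefl by blast
    then show ?thesis unfolding h_def using fin by (simp add: psubset_card_mono Suc_le_eq)
  qed
  then have "h ` S = {1..card S}"
    using inj by (intro card_subset_eq) (auto simp: card_image)
  then have bij: "bij_betw h S {1..card S}" using inj by (simp add: bij_betw_def)
  define l where "l = inv_into S h"
  have l: "bij_betw l {1..card S} S" unfolding l_def using bij by (rule bij_betw_inv_into)
  have hl: "h (l i) = i" "l i \<in> S" if "i \<in> {1..card S}" for i
    using that bij l by (auto simp: l_def bij_betw_inv_into_right dest: bij_betwE)
  have "r (l i) (l j)" if "i \<in> {1..card S}" "j \<in> {1..card S}" "i < j" for i j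
    by (metis that hl mono total less_asym)
  then show ?thesis using l by blast
qed

text \<open>The least point comes first and the others follow by angle around it. By
  \<open>orient_pos_of_fan\<close> every increasing triple then turns counterclockwise, which makes
  the diagonals of every quadruple cross.\<close>

lemma ex_cyclic_labeling:
  assumes P: "convex_point_set P" and n: "card P = n"
  shows "\<exists>l. labeling n P l \<and> (\<forall>a b c d. 1 \<le> a \<longrightarrow> a < b \<longrightarrow> b < c \<longrightarrow> c < d \<longrightarrow> d \<le> n \<longrightarrow>
    closed_segment (l a) (l c) \<inter> closed_segment (l b) (l d) \<noteq> {})"
proof (cases "P = {}")
  case True
  then show ?thesis using n by (auto simp: labeling_def bij_betw_def)
next
  case False
  have fin: "finite P" using P by (simp add: convex_point_set_def)
  obtain p where p: "p \<in> P" "\<And>q. q \<in> P \<Longrightarrow> q \<noteq> p \<Longrightarrow> lex_less p q"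
    using ex_lex_least[OF fin False] by blast
  define r where "r x y \<longleftrightarrow> x = p \<and> y \<noteq> p \<or> orient p x y > 0" for x y
  have anti: "orient p y x = - orient p x y" for x y by (simp add: orient_def algebra_simps)
  have self: "orient p p x = 0" "orient p x p = 0" "orient p x x = 0" for x
    by (simp_all add: orient_def)
  have "\<exists>l. bij_betw l {1..card P} P \<and> (\<forall>i\<in>{1..card P}. \<forall>j\<in>{1..card P}. i < j \<longrightarrow> r (l i) (l j))"
  proof (rule ex_increasing_enumeration[OF fin])
    show "\<not> r x x" for x by (auto simp: r_def self)
    show "r x z" if "x \<in> P" "y \<in> P" "z \<in> P" "r x y" "r y z" for x y z
    proof -
      have "y \<noteq> p" "z \<noteq> p" using that self by (auto simp: r_def)
      then show ?thesis
        using that orient_trans[of p x y z] p by (auto simp: r_def)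
    qed
    show "r x y \<or> r y x" if "x \<in> P" "y \<in> P" "x \<noteq> y" for x y
    proof (cases "x = p \<or> y = p")
      case True
      then show ?thesis using that by (auto simp: r_def)
    next
      case False
      then have "orient p x y \<noteq> 0"
        using orient_neq_0[OF P, of p x y] p that by auto
      then show ?thesis using anti[of y x] by (auto simp: r_def)
    qed
  qed
  then obtain l where l: "bij_betw l {1..n} P"
    and r: "\<And>i j. i \<in> {1..n} \<Longrightarrow> j \<in> {1..n} \<Longrightarrow> i < j \<Longrightarrow> r (l i) (l j)"
    unfolding n by blast
  have lP: "l i \<in> P" if "i \<in> {1..n}" for i using l that by (auto dest: bij_betwE)
  have pos: "orient (l i) (l j) (l m) > 0" if "1 \<le> i" "i < j" "j < m" "m \<le> n" for i j m
  proof -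
    have ij: "r (l i) (l j)" and im: "r (l i) (l m)" and jm: "r (l j) (l m)"
      using that by (auto intro: r)
    have "l j \<noteq> p" using ij self by (auto simp: r_def)
    then have jm': "orient p (l j) (l m) > 0" using jm by (simp add: r_def)
    show ?thesis
    proof (cases "l i = p")
      case True
      then show ?thesis using jm' by simp
    next
      case False
      then have "orient p (l i) (l j) > 0" "orient p (l i) (l m) > 0"
        using ij im by (auto simp: r_def)
      moreover have "{p, l i, l j, l m} \<subseteq> P" using p(1) lP that by auto
      ultimately show ?thesis using jm' orient_pos_of_fan[OF P] by blast
    qed
  qed
  have "closed_segment (l a) (l c) \<inter> closed_segment (l b) (l d) \<noteq> {}"
    if "1 \<le> a" "a < b" "b < c" "c < d" "d \<le> n" for a b c d
    using that by (intro positively_oriented_diagonals_cross pos) simp_all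
  then show ?thesis using l unfolding labeling_def by blast
qed

subsection \<open>Non-crossing families of intervals\<close>

text \<open>The index set and the end maps are parameters, so that intervals can be indexed by edges
  or by left ends, and their ends moved by a permutation. One interleaving pattern suffices, as
  \<open>i\<close> and \<open>j\<close> may be exchanged.\<close>

definition noncrossing :: "'i set \<Rightarrow> ('i \<Rightarrow> nat) \<Rightarrow> ('i \<Rightarrow> nat) \<Rightarrow> bool" where
  "noncrossing I u v \<longleftrightarrow> (\<forall>i\<in>I. u i < v i) \<and>
    (\<forall>i\<in>I. \<forall>j\<in>I. \<not> (u i < u j \<and> u j < v i \<and> v i < v j))"

text \<open>If \<open>w j = v i\<close>, then \<open>u j < u i\<close>, and for \<open>w\<close> the interval of \<open>j\<close> crosses that of \<open>i\<close>.\<close>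

lemma noncrossing_no_last_difference:
  assumes "noncrossing I u v" "noncrossing I u w" "inj_on u I" "inj_on v I" "v ` I = w ` I"
    and "i \<in> I" "v i < w i" and later: "\<And>j. j \<in> I \<Longrightarrow> u i < u j \<Longrightarrow> v j = w j"
  shows False
proof -
  obtain j where j: "j \<in> I" "w j = v i" using assms(5,6) by (metis imageE imageI)
  have "j \<noteq> i" using j assms(7) by auto
  have "\<not> u i < u j"
  proof
    assume "u i < u j"
    then have "v j = v i" using later j by simp
    then show False using assms(4,6) j \<open>j \<noteq> i\<close> by (auto dest: inj_onD)
  qed
  moreover have "u j \<noteq> u i" using assms(3,6) j \<open>j \<noteq> i\<close> by (auto dest: inj_onD)
  moreover have "u i < v i" using assms(1,6) by (auto simp: noncrossing_def)
  ultimately show False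
    using assms(2,6,7) j unfolding noncrossing_def by (metis linorder_neqE_nat)
qed

text \<open>As with brackets, the positions of the opening and closing ends fix the pairing. At the
  index of largest opening end where \<open>v\<close> and \<open>w\<close> differ, both signs of the
  difference are excluded by \<open>noncrossing_no_last_difference\<close>.\<close>

lemma noncrossing_unique:
  assumes "finite I" "noncrossing I u v" "noncrossing I u w"
    and "inj_on u I" "inj_on v I" "inj_on w I" "v ` I = w ` I" "i \<in> I"
  shows "v i = w i"
proof (rule ccontr)
  assume "v i \<noteq> w i"
  define D where "D = {i \<in> I. v i \<noteq> w i}"
  have D: "finite (u ` D)" "u ` D \<noteq> {}" using assms \<open>v i \<noteq> w i\<close> by (auto simp: D_def)
  obtain j where j: "j \<in> D" "u j = Max (u ` D)" using Max_in[OF D] by auto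
  have later: "v m = w m" if "m \<in> I" "u j < u m" for m
    using that Max_ge[OF D(1), of "u m"] j(2) by (force simp: D_def)
  consider "v j < w j" | "w j < v j" using j(1) by (force simp: D_def)
  moreover have "j \<in> I" using j(1) by (simp add: D_def)
  ultimately show False
    using noncrossing_no_last_difference[OF assms(2,3,4,5,7) _ _ later]
      noncrossing_no_last_difference[OF assms(3,2,4,6) assms(7)[symmetric] _ _ later[symmetric]]
    by cases
qed

text \<open>Composing each such \<open>\<sigma>\<close> with each rearrangement
  \<open>\<tau>\<close> of \<open>b\<close>
  I\<open>yields distinct permutations of\<close>V\<open>. Indeed the composite agrees with\<close>\<sigma>\<open>off\<close>b
  \<open>I\<close>, in particular at the opening ends, and it has the same set of closing positions,
  so \<open>noncrossing_unique\<close> recovers \<open>\<sigma>\<close>.\<close>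

lemma card_noncrossing_permutations:
  fixes V :: "nat set"
  assumes "finite V" "finite I" "inj_on a I" "inj_on b I"
    and "b ` I \<subseteq> V" "a ` I \<inter> b ` I = {}"
  shows "card {\<sigma>. \<sigma> permutes V \<and> noncrossing I (\<sigma> \<circ> a) (\<sigma> \<circ> b)} * fact (card I) \<le> fact (card V)"
    (is "card ?X * _ \<le> _")
proof -
  let ?T = "{\<tau>. \<tau> permutes b ` I}"
  have inj: "inj_on (\<lambda>(\<sigma>, \<tau>). \<sigma> \<circ> \<tau>) (?X \<times> ?T)"
  proof (rule inj_onI; clarify)
    fix \<sigma> \<tau> \<sigma>' \<tau>'
    assume \<sigma>: "\<sigma> permutes V" "noncrossing I (\<sigma> \<circ> a) (\<sigma> \<circ> b)"
      and \<sigma>': "\<sigma>' permutes V" "noncrossing I (\<sigma>' \<circ> a) (\<sigma>' \<circ> b)"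
      and \<tau>: "\<tau> permutes b ` I" and \<tau>': "\<tau>' permutes b ` I"
      and eq: "\<sigma> \<circ> \<tau> = \<sigma>' \<circ> \<tau>'"
    have eq': "\<sigma> (\<tau> x) = \<sigma>' (\<tau>' x)" for x using fun_cong[OF eq, of x] by simp
    have out: "\<sigma> x = \<sigma>' x" if "x \<notin> b ` I" for x
      using eq'[of x] that \<tau> \<tau>' by (simp add: permutes_not_in)
    have "\<sigma> (a i) = \<sigma>' (a i)" if "i \<in> I" for i
      using out assms(6) that by blast
    then have nc: "noncrossing I (\<sigma> \<circ> a) (\<sigma>' \<circ> b)"
      using \<sigma>'(2) by (simp add: noncrossing_def)
    have im: "(\<sigma> \<circ> b) ` I = (\<sigma>' \<circ> b) ` I"
      using arg_cong[OF eq, of "\<lambda>f. f ` (b ` I)"] permutes_image[OF \<tau>] permutes_image[OF \<tau>']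
      by (simp only: image_comp[symmetric])
    have "inj \<sigma>" "inj \<sigma>'" using \<sigma> \<sigma>' by (auto intro: permutes_inj)
    then have injs: "inj_on (\<sigma> \<circ> a) I" "inj_on (\<sigma> \<circ> b) I" "inj_on (\<sigma>' \<circ> b) I"
      using assms(3,4) by (auto intro: comp_inj_on inj_on_subset)
    have "\<sigma> (b i) = \<sigma>' (b i)" if "i \<in> I" for i
      using noncrossing_unique[OF assms(2) \<sigma>(2) nc injs im that] by simp
    with out have "\<sigma> = \<sigma>'" by (metis ext imageE)
    moreover from this have "\<tau> = \<tau>'" using eq' \<open>inj \<sigma>\<close> by (auto dest: injD)
    ultimately show "\<sigma> = \<sigma>' \<and> \<tau> = \<tau>'" by blast
  qed
  have "(\<lambda>(\<sigma>, \<tau>). \<sigma> \<circ> \<tau>) ` (?X \<times> ?T) \<subseteq> {\<pi>. \<pi> permutes V}"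
    using assms(5) by (auto intro: permutes_compose permutes_subset)
  then have "card (?X \<times> ?T) \<le> card {\<pi>. \<pi> permutes V}"
    by (rule card_inj_on_le[OF inj]) (simp add: finite_permutations assms(1))
  moreover have "card ?T = fact (card I)"
    using assms(2,4) by (intro card_permutations) (auto simp: card_image)
  moreover have "card {\<pi>. \<pi> permutes V} = fact (card V)"
    using assms(1) by (intro card_permutations) auto
  ultimately show ?thesis by (simp add: card_cartesian_product)
qed

subsection \<open>Counting non-crossing matchings\<close>

lemma matching_edge:
  assumes "matching n M" "e \<in> M"
  shows "e = {Min e, Max e}" "Min e < Max e" "Min e \<in> e" "Max e \<in> e"
proof -
  obtain x y where e: "e = {x, y}" "x \<noteq> y"
    using assms by (auto simp: matching_def card_2_iff)
  then show "e = {Min e, Max e}" "Min e < Max e" "Min e \<in> e" "Max e \<in> e"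
    by (auto simp: min_def max_def)
qed

lemma matching_common_endpoint:
  assumes "matching n M" "e \<in> M" "e' \<in> M" "x \<in> e" "x \<in> e'"
  shows "e = e'"
  using assms unfolding matching_def pairwise_def disjnt_def by blast

lemma matching_inj_on:
  assumes "matching n M" "\<And>e. e \<in> M \<Longrightarrow> c e \<in> e"
  shows "inj_on c M"
  by (rule inj_onI) (metis assms matching_common_endpoint)

text \<open>Indexing edges by their left ends gives both matchings the same index set and the
  opening map \<open>id\<close>, as \<open>noncrossing_unique\<close> requires. The closing map
  \<open>Max \<circ> inv_into N Min\<close> sends a left end to the right end of its edge.\<close>

lemma noncrossing_matching_eq:
  assumes M: "matching n M" "noncrossing M Min Max"
    and M': "matching n M'" "noncrossing M' Min Max"
    and "Min ` M = Min ` M'" "Max ` M = Max ` M'"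
  shows "M = M'"
proof -
  have step: "noncrossing (Min ` N) id (Max \<circ> inv_into N Min) \<and> inj_on (Max \<circ> inv_into N Min) (Min ` N)
      \<and> (Max \<circ> inv_into N Min) ` Min ` N = Max ` N
      \<and> N = (\<lambda>x. {x, (Max \<circ> inv_into N Min) x}) ` Min ` N"
    if N: "matching n N" "noncrossing N Min Max" for N :: "nat set set"
  proof -
    have inj: "inj_on Min N" "inj_on Max N"
      using matching_inj_on[OF N(1)] matching_edge(3,4)[OF N(1)] by blast+
    have inv: "inv_into N Min (Min e) = e" if "e \<in> N" for e
      using inj(1) that by simp
    have "(\<lambda>e. {Min e, Max e}) ` N = (\<lambda>e. e) ` N"
      by (rule image_cong) (simp_all add: matching_edge(1)[OF N(1), symmetric])
    moreover have "(\<lambda>x. {x, (Max \<circ> inv_into N Min) x}) ` Min ` N = (\<lambda>e. {Min e, Max e}) ` N"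
      unfolding image_image by (rule image_cong) (simp_all add: inv)
    moreover have "(Max \<circ> inv_into N Min) ` Min ` N = Max ` N"
      unfolding image_image by (rule image_cong) (simp_all add: inv)
    moreover have "inj_on (Max \<circ> inv_into N Min) (Min ` N)"
      using inj(2) inv by (auto simp: inj_on_def)
    moreover have "noncrossing (Min ` N) id (Max \<circ> inv_into N Min)"
      using N(2) by (simp add: noncrossing_def inv)
    ultimately show ?thesis by simp
  qed
  let ?f = "Max \<circ> inv_into M Min" and ?g = "Max \<circ> inv_into M' Min"
  have "?f x = ?g x" if "x \<in> Min ` M" for x
    using step[OF M] step[OF M', folded assms(5,6)] that matching_finite[OF M(1)]
    by (intro noncrossing_unique[of "Min ` M" id ?f ?g x]) simp_all
  then have "(\<lambda>x. {x, ?f x}) ` Min ` M = (\<lambda>x. {x, ?g x}) ` Min ` M'"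
    unfolding assms(5)[symmetric] by (intro image_cong) auto
  then show ?thesis using step[OF M] step[OF M'] by argo
qed

lemma card_noncrossing_matchings:
  "card {M. matching n M \<and> card M = k \<and> noncrossing M Min Max} \<le> (n choose k)\<^sup>2"
proof -
  let ?A = "{M. matching n M \<and> card M = k \<and> noncrossing M Min Max}"
  let ?B = "{S. S \<subseteq> {1..n} \<and> card S = k}"
  let ?\<phi> = "\<lambda>M :: nat set set. (Min ` M, Max ` M)"
  have "inj_on ?\<phi> ?A"
    by (intro inj_onI noncrossing_matching_eq[where n = n]; simp)
  moreover have "?\<phi> M \<in> ?B \<times> ?B" if "M \<in> ?A" for M
  proof -
    have M: "matching n M" using that by simp
    have "inj_on Min M" "inj_on Max M"
      using matching_inj_on[OF M] matching_edge(3,4)[OF M] by blast+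
    moreover have "Min ` M \<subseteq> {1..n}" "Max ` M \<subseteq> {1..n}"
      using matching_edge(3,4)[OF M] M unfolding matching_def by blast+
    ultimately show ?thesis using that by (simp add: card_image)
  qed
  ultimately have "card ?A \<le> card (?B \<times> ?B)"
    by (intro card_inj_on_le[of ?\<phi>]) auto
  also have "card ?B = n choose k" using n_subsets[of "{1..n}" k] by simp
  then have "card (?B \<times> ?B) = (n choose k)\<^sup>2"
    by (simp add: card_cartesian_product power2_eq_square)
  finally show ?thesis .
qed

text \<open>Here \<open>\<sigma>\<close> is read as sending a label to its position in a cyclic
  enumeration; the minimum and maximum are the positions of the ends of the edge.\<close>

definition noncrossing_wrt :: "(nat \<Rightarrow> nat) \<Rightarrow> nat set set \<Rightarrow> bool" where
  "noncrossing_wrt \<sigma> M \<longleftrightarrow> noncrossing M (\<lambda>e. Min (\<sigma> ` e)) (\<lambda>e. Max (\<sigma> ` e))"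

text \<open>Which end of an edge opens depends on \<open>\<sigma>\<close>. Once the set
  \<open>S\<close> of reversed edges is fixed, the opening and closing labels no longer do, and
  \<open>card_noncrossing_permutations\<close> applies; the factor \<open>2 ^ card M\<close> counts
  the sets \<open>S\<close>.\<close>

lemma card_permutations_noncrossing_wrt:
  assumes M: "matching n M"
  shows "card {\<sigma>. \<sigma> permutes {1..n} \<and> noncrossing_wrt \<sigma> M} * fact (card M)
    \<le> 2 ^ card M * fact n"
proof -
  define a b :: "nat set set \<Rightarrow> nat set \<Rightarrow> nat"
    where "a S e = (if e \<in> S then Max e else Min e)"
      and "b S e = (if e \<in> S then Min e else Max e)" for S e
  let ?X = "\<lambda>S. {\<sigma>. \<sigma> permutes {1..n} \<and> noncrossing M (\<sigma> \<circ> a S) (\<sigma> \<circ> b S)}"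
  have fin: "finite M" using M by (rule matching_finite)
  have X: "card (?X S) * fact (card M) \<le> fact n" for S
  proof -
    have ab: "a S e \<in> e" "b S e \<in> e" "a S e \<noteq> b S e" if "e \<in> M" for e
      using matching_edge(2-4)[OF M that] by (auto simp: a_def b_def)
    have "a S e \<noteq> b S e'" if "e \<in> M" "e' \<in> M" for e e'
      using ab[OF that(1)] ab[OF that(2)] matching_common_endpoint[OF M that, of "a S e"] by auto
    then have "a S ` M \<inter> b S ` M = {}" by blast
    moreover have "b S ` M \<subseteq> {1..n}" using ab M unfolding matching_def by blast
    ultimately show ?thesis
      using card_noncrossing_permutations[of "{1..n}" M "a S" "b S"] fin ab
      by (simp add: matching_inj_on[OF M])
  qed
  have "{\<sigma>. \<sigma> permutes {1..n} \<and> noncrossing_wrt \<sigma> M} \<subseteq> (\<Union>S\<in>Pow M. ?X S)"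
  proof (rule subsetI; clarify)
    fix \<sigma>
    assume \<sigma>: "\<sigma> permutes {1..n}" "noncrossing_wrt \<sigma> M"
    \<comment> \<open>The edges whose larger label comes first under
      \<open>\<sigma>\<close>.\<close>
    define S where "S = {e \<in> M. \<sigma> (Max e) < \<sigma> (Min e)}"
    have "Min (\<sigma> ` e) = \<sigma> (a S e) \<and> Max (\<sigma> ` e) = \<sigma> (b S e)" if "e \<in> M" for e
    proof -
      have "\<sigma> ` e = {\<sigma> (Min e), \<sigma> (Max e)}"
        using matching_edge(1)[OF M that] by (metis image_empty image_insert)
      then show ?thesis using that by (auto simp: a_def b_def S_def)
    qed
    then have "noncrossing M (\<sigma> \<circ> a S) (\<sigma> \<circ> b S)"
      using \<sigma>(2) by (simp add: noncrossing_wrt_def noncrossing_def)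
    then show "\<sigma> \<in> (\<Union>S\<in>Pow M. ?X S)" using \<sigma>(1) by (auto simp: S_def)
  qed
  then have "card {\<sigma>. \<sigma> permutes {1..n} \<and> noncrossing_wrt \<sigma> M} \<le> card (\<Union>S\<in>Pow M. ?X S)"
    using fin by (intro card_mono) (auto intro: finite_subset[OF _ finite_permutations[of "{1..n}"]])
  also have "\<dots> \<le> (\<Sum>S\<in>Pow M. card (?X S))" using fin by (intro card_UN_le) simp
  finally have "card {\<sigma>. \<sigma> permutes {1..n} \<and> noncrossing_wrt \<sigma> M} * fact (card M)
      \<le> (\<Sum>S\<in>Pow M. card (?X S)) * fact (card M)"
    by (rule mult_le_mono1)
  also have "\<dots> \<le> (\<Sum>S\<in>Pow M. fact n)" unfolding sum_distrib_right by (intro sum_mono X)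
  also have "\<dots> = 2 ^ card M * fact n" using fin by (simp add: card_Pow)
  finally show ?thesis .
qed

section \<open>The union bound and its arithmetic\<close>

text \<open>The quotient of \<open>k ^ k\<close> by \<open>fact k\<close> is a single term of the
  exponential series at \<open>k\<close>, and \<open>exp 1\<close> is at most 3.\<close>

lemma power_self_le_3_power_fact: "k ^ k \<le> 3 ^ k * (fact k :: nat)"
proof -
  have "real k ^ k / fact k \<le> exp (real k)"
  proof -
    have "(\<Sum>i\<in>{k}. real k ^ i /\<^sub>R fact i) \<le> (\<Sum>i. real k ^ i /\<^sub>R fact i)"
      by (rule sum_le_suminf[OF summable_exp_generic]) auto
    then show ?thesis by (simp add: exp_def field_simps)
  qed
  also have "exp (real k) = exp 1 ^ k" by (simp add: exp_of_nat_mult[symmetric])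
  also have "\<dots> \<le> 3 ^ k" by (intro power_mono exp_le) simp
  finally have "real (k ^ k) \<le> real (3 ^ k * fact k)" by (simp add: field_simps)
  then show ?thesis by (simp only: of_nat_le_iff)
qed

lemma ex_permutation_no_common_noncrossing_matching:
  fixes n k :: nat
  assumes n: "n \<ge> 1" and k: "k ^ 3 \<ge> 64 * n\<^sup>2"
  shows "\<exists>\<sigma>. \<sigma> permutes {1..n} \<and>
    (\<nexists>M. matching n M \<and> card M = k \<and> noncrossing M Min Max \<and> noncrossing_wrt \<sigma> M)"
proof (rule ccontr)
  assume contra: "\<not> ?thesis"
  define N where "N = {M. matching n M \<and> card M = k \<and> noncrossing M Min Max}"
  let ?X = "\<lambda>M. {\<sigma>. \<sigma> permutes {1..n} \<and> noncrossing_wrt \<sigma> M}"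
  have finN: "finite N"
    by (rule finite_subset[of _ "Pow (Pow {1..n})"]) (auto simp: N_def matching_def)
  \<comment> \<open>If every permutation kept some matching with \<open>k\<close> edges, the sets
    \<open>?X M\<close> would cover all permutations.\<close>
  have "{\<sigma>. \<sigma> permutes {1..n}} \<subseteq> (\<Union>M\<in>N. ?X M)" using contra by (auto simp: N_def)
  then have "card {\<sigma>. \<sigma> permutes {1..n}} \<le> card (\<Union>M\<in>N. ?X M)"
    using finN by (intro card_mono) (auto intro: finite_subset[OF _ finite_permutations[of "{1..n}"]])
  also have "\<dots> \<le> (\<Sum>M\<in>N. card (?X M))" using finN by (rule card_UN_le)
  finally have "fact n \<le> (\<Sum>M\<in>N. card (?X M))"
    using card_permutations[of "{1..n}" n] by simp
  then have "fact n * fact k \<le> (\<Sum>M\<in>N. card (?X M)) * fact k" by (rule mult_le_mono1)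
  also have "\<dots> \<le> (\<Sum>M\<in>N. 2 ^ k * fact n)"
    unfolding sum_distrib_right
    by (intro sum_mono) (use card_permutations_noncrossing_wrt in \<open>auto simp: N_def\<close>)
  also have "\<dots> \<le> (n choose k)\<^sup>2 * (2 ^ k * fact n)"
    using card_noncrossing_matchings[of n k] by (simp add: N_def)
  finally have "fact n * fact k \<le> fact n * ((n choose k)\<^sup>2 * 2 ^ k)" by (simp add: mult_ac)
  then have "fact k \<le> (n choose k)\<^sup>2 * 2 ^ k"
    by (subst (asm) mult_le_cancel1) auto
  \<comment> \<open>The extra factor turns each binomial coefficient into a falling factorial, which
    is at most \<open>n ^ k\<close>.\<close>
  then have "fact k * (fact k)\<^sup>2 \<le> ((n choose k)\<^sup>2 * 2 ^ k) * (fact k :: nat)\<^sup>2"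
    by (rule mult_le_mono1)
  also have "\<dots> = ((n choose k) * fact k)\<^sup>2 * 2 ^ k" by (simp add: power_mult_distrib)
  also have "\<dots> \<le> (n ^ k)\<^sup>2 * 2 ^ k"
    by (intro mult_le_mono1 power_mono binomial_fact_pow) auto
  finally have fact3: "(fact k :: nat) ^ 3 \<le> (n\<^sup>2) ^ k * 2 ^ k"
    by (simp add: power2_eq_square power3_eq_cube power_mult_distrib mult_ac)
  have "(64 * n\<^sup>2) ^ k \<le> (k ^ 3) ^ k" using k by (intro power_mono) auto
  also have "\<dots> = (k ^ k) ^ 3" by (simp add: power_mult[symmetric] mult.commute)
  also have "\<dots> \<le> (3 ^ k * fact k) ^ 3" by (intro power_mono power_self_le_3_power_fact) simp
  also have "\<dots> = 27 ^ k * (fact k) ^ 3"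
    by (simp add: power_mult_distrib power_mult[symmetric] mult.commute[of k 3]) (simp add: power_mult)
  also have "\<dots> \<le> 27 ^ k * ((n\<^sup>2) ^ k * 2 ^ k)" using fact3 by (rule mult_le_mono2)
  also have "\<dots> = (27 * (n\<^sup>2 * 2)) ^ k" by (simp only: power_mult_distrib)
  \<comment> \<open>The 27 is the cube of the bound on \<open>exp 1\<close> and the 2 comes from the
    orientations. The constant 4 in the theorem works because its cube 64 exceeds 54.\<close>
  also have "27 * (n\<^sup>2 * 2) = 54 * n\<^sup>2" by simp
  finally have "(64 * n\<^sup>2) ^ k \<le> (54 * n\<^sup>2) ^ k" .
  \<comment> \<open>The strict comparison of powers needs a nonzero exponent.\<close>
  moreover have "k \<noteq> 0"
  proof
    assume "k = 0"
    then show False using k n by simp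
  qed
  then have "(54 * n\<^sup>2) ^ k < (64 * n\<^sup>2) ^ k" using n by (intro power_strict_mono) simp_all
  ultimately show False by linarith
qed

section \<open>From segments to intervals\<close>

text \<open>Two edges with interleaving positions are diagonals of four points in cyclic order, so
  their segments meet. This carries the geometric hypothesis over to the counting.\<close>

lemma crossing_free_noncrossing_wrt:
  assumes M: "matching n M" and \<sigma>: "\<sigma> permutes {1..n}"
    and free: "crossing_free (l \<circ> \<sigma>) M"
    and cyclic: "\<And>a b c d. 1 \<le> a \<Longrightarrow> a < b \<Longrightarrow> b < c \<Longrightarrow> c < d \<Longrightarrow> d \<le> n \<Longrightarrow>
      closed_segment (l a) (l c) \<inter> closed_segment (l b) (l d) \<noteq> {}"
  shows "noncrossing_wrt \<sigma> M"
proof -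
  have edge: "\<exists>x y. e = {x, y} \<and> \<sigma> x = Min (\<sigma> ` e) \<and> \<sigma> y = Max (\<sigma> ` e) \<and> \<sigma> x < \<sigma> y
      \<and> \<sigma> x \<in> {1..n} \<and> \<sigma> y \<in> {1..n}" if "e \<in> M" for e
  proof -
    define x where "x = (if \<sigma> (Min e) < \<sigma> (Max e) then Min e else Max e)"
    define y where "y = (if \<sigma> (Min e) < \<sigma> (Max e) then Max e else Min e)"
    have e: "e = {x, y}" "x \<noteq> y"
      using matching_edge(1,2)[OF M that] by (simp_all add: x_def y_def insert_commute)
    have "\<sigma> x \<noteq> \<sigma> y" using e permutes_inj[OF \<sigma>] by (auto dest: injD)
    then have lt: "\<sigma> x < \<sigma> y" by (auto simp: x_def y_def split: if_splits)
    have "\<sigma> x \<in> {1..n}" "\<sigma> y \<in> {1..n}"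
      using M that e unfolding matching_def permutes_in_image[OF \<sigma>] by blast+
    then show ?thesis using e(1) lt by (intro exI[of _ x] exI[of _ y]) auto
  qed
  have False if ee': "e \<in> M" "e' \<in> M" "Min (\<sigma> ` e) < Min (\<sigma> ` e')"
    "Min (\<sigma> ` e') < Max (\<sigma> ` e)" "Max (\<sigma> ` e) < Max (\<sigma> ` e')" for e e'
  proof -
    obtain a c where ac: "e = {a, c}" "\<sigma> a = Min (\<sigma> ` e)" "\<sigma> c = Max (\<sigma> ` e)" "\<sigma> a \<in> {1..n}"
      using edge[OF ee'(1)] by blast
    obtain b d where bd: "e' = {b, d}" "\<sigma> b = Min (\<sigma> ` e')" "\<sigma> d = Max (\<sigma> ` e')" "\<sigma> d \<in> {1..n}"
      using edge[OF ee'(2)] by blast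
    have "e \<noteq> e'" using ee'(3) by auto
    then have "closed_segment ((l \<circ> \<sigma>) a) ((l \<circ> \<sigma>) c) \<inter> closed_segment ((l \<circ> \<sigma>) b) ((l \<circ> \<sigma>) d) = {}"
      using free ee'(1,2) ac(1) bd(1) unfolding crossing_free_def by blast
    moreover have "\<sigma> a < \<sigma> b" "\<sigma> b < \<sigma> c" "\<sigma> c < \<sigma> d"
      using ee' ac(2,3) bd(2,3) by simp_all
    ultimately show False
      using cyclic[of "\<sigma> a" "\<sigma> b" "\<sigma> c" "\<sigma> d"] ac(4) bd(4) by simp
  qed
  then show ?thesis
    using edge unfolding noncrossing_wrt_def noncrossing_def by metis
qed

text \<open>Allows a large compatible matching to be trimmed to exactly the number of edges that the
  counting treats.\<close>

lemma compatible_matching_subset: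
  assumes "compatible_matching n L M" "M' \<subseteq> M"
  shows "compatible_matching n L M'"
  using assms unfolding compatible_matching_def matching_def crossing_free_def
  by (meson pairwise_subset subsetD)

theorem theorem2:
  fixes n :: nat and k :: real and P1 P2 :: "point set"
  assumes "n \<ge> 1"
    and "k = 4 * real n powr (2 / 3)"
    and "convex_point_set P1" and "card P1 = n"
    and "convex_point_set P2" and "card P2 = n"
  shows "\<exists>l1 l2. labeling n P1 l1 \<and> labeling n P2 l2 \<and>
    real (max_compatible_matching_size n {l1, l2}) < k"
proof -
  \<comment> \<open>Rounding up keeps the cube at least \<open>64 * n\<^sup>2\<close>, and a natural
    number is at least \<open>k\<close> exactly when it is at least \<open>K\<close>.\<close>
  define K where "K = nat \<lceil>k\<rceil>"
  have "k \<ge> 0" using assms(2) by simp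
  have "k ^ 3 = 64 * (real n powr (2 / 3)) ^ 3" by (simp add: assms(2) power_mult_distrib)
  also have "(real n powr (2 / 3)) ^ 3 = real n powr 2"
    using assms(1) by (simp add: powr_power)
  also have "\<dots> = (real n)\<^sup>2" using assms(1) by simp
  finally have "64 * (real n)\<^sup>2 = k ^ 3" by simp
  also have "\<dots> \<le> real K ^ 3" using \<open>k \<ge> 0\<close> by (intro power_mono) (auto simp: K_def)
  finally have "real (64 * n\<^sup>2) \<le> real (K ^ 3)" by simp
  then have "64 * n\<^sup>2 \<le> K ^ 3" by (simp only: of_nat_le_iff)
  then obtain \<sigma> where \<sigma>: "\<sigma> permutes {1..n}"
    and none: "\<nexists>M. matching n M \<and> card M = K \<and> noncrossing M Min Max \<and> noncrossing_wrt \<sigma> M"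
    using ex_permutation_no_common_noncrossing_matching[OF assms(1)] by blast
  obtain l1 where l1: "labeling n P1 l1"
    and cyclic1: "\<And>a b c d. 1 \<le> a \<Longrightarrow> a < b \<Longrightarrow> b < c \<Longrightarrow> c < d \<Longrightarrow> d \<le> n \<Longrightarrow>
      closed_segment (l1 a) (l1 c) \<inter> closed_segment (l1 b) (l1 d) \<noteq> {}"
    using ex_cyclic_labeling[OF assms(3,4)] by blast
  obtain l2 where l2: "labeling n P2 l2"
    and cyclic2: "\<And>a b c d. 1 \<le> a \<Longrightarrow> a < b \<Longrightarrow> b < c \<Longrightarrow> c < d \<Longrightarrow> d \<le> n \<Longrightarrow>
      closed_segment (l2 a) (l2 c) \<inter> closed_segment (l2 b) (l2 d) \<noteq> {}"
    using ex_cyclic_labeling[OF assms(5,6)] by blast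
  have "labeling n P2 (l2 \<circ> \<sigma>)"
    using l2 permutes_imp_bij[OF \<sigma>] unfolding labeling_def by (rule bij_betw_trans[rotated])
  moreover have "real (max_compatible_matching_size n {l1, l2 \<circ> \<sigma>}) < k"
  proof (rule ccontr)
    let ?C = "{M. compatible_matching n {l1, l2 \<circ> \<sigma>} M}"
    assume "\<not> real (max_compatible_matching_size n {l1, l2 \<circ> \<sigma>}) < k"
    then have "K \<le> max_compatible_matching_size n {l1, l2 \<circ> \<sigma>}"
      by (simp add: K_def ceiling_le_iff)
    moreover have "Max (card ` ?C) \<in> card ` ?C"
      using compatible_matching_empty[of n "{l1, l2 \<circ> \<sigma>}"] compatible_matchings_finite
      by (intro Max_in) blast+
    ultimately obtain M where M: "compatible_matching n {l1, l2 \<circ> \<sigma>} M" "K \<le> card M"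
      unfolding max_compatible_matching_size_def by auto
    obtain M' where M': "M' \<subseteq> M" "card M' = K"
      using obtain_subset_with_card_n[OF M(2)] by blast
    have C: "compatible_matching n {l1, l2 \<circ> \<sigma>} M'"
      using M(1) M'(1) by (rule compatible_matching_subset)
    \<comment> \<open>Writing \<open>l1\<close> as \<open>l1 \<circ> id\<close> lets one lemma serve
      both point sets; \<open>noncrossing_wrt id\<close> is then non-crossing with respect to
      \<open>Min\<close> and \<open>Max\<close>.\<close>
    then have m: "matching n M'" and free: "crossing_free (l1 \<circ> id) M'" "crossing_free (l2 \<circ> \<sigma>) M'"
      by (auto simp: compatible_matching_def)
    have "noncrossing_wrt id M'"
      using m permutes_id free(1) cyclic1 by (rule crossing_free_noncrossing_wrt)
    moreover have "noncrossing_wrt \<sigma> M'"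
      using m \<sigma> free(2) cyclic2 by (rule crossing_free_noncrossing_wrt)
    ultimately show False using none m M'(2) by (auto simp: noncrossing_wrt_def)
  qed
  ultimately show ?thesis using l1 by blast
qed

end
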